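(* Let $C=(a_1,a_2,a_3,a_4,a_5,a_6)$ be a tetrahedral curve with $a_6=\max\{a_1,\dots,a_6\}>0$. Let $w$ be the maximal weight of a facet of the tetrahedron $T=T(C)$, i.e. \[ w=\max\{a_1+a_2+a_3,\;a_1+a_4+a_5,\;a_2+a_4+a_6,\;a_3+a_5+a_6\}. \] Then the following conditions are equivalent: (a) $C$ is not S-minimal. (b) $a_1+a_6\le w$. (c) One can reduce any of the facets of $T$ having maximal weight $w$.
   Context: Let $k$ be a field and $R=k[a,b,c,d]$. For integers $a_1,\dots,a_6\ge0$, the tetrahedral curve $(a_1,\dots,a_6)$ is the subscheme of $\mathbb P^3$ with saturated ideal $(a,b)^{a_1}\cap(a,c)^{a_2}\cap(a,d)^{a_3}\cap(b,c)^{a_4}\cap(b,d)^{a_5}\cap(c,d)^{a_6}$; $a_i$ is the weight of the $i$-th line $\ell_i$. The six lines are the edges of a tetrahedron $T=T(C)$ whose four facets have edge index sets $\{1,2,3\},\{1,4,5\},\{2,4,6\},\{3,5,6\}$; the weight of a facet is the sum of the weights of its three edges. Reductions. For a tetrahedral curve with not all $a_i$ zero consider the systems (A): $a_1+a_2\ge a_4$, $a_1+a_3\ge a_5$, $a_2+a_3\ge a_6$; (B): $a_1+a_4\ge a_2$, $a_1+a_5\ge a_3$, $a_4+a_5\ge a_6$; (C): $a_2+a_4\ge a_1$, $a_2+a_6\ge a_3$, $a_4+a_6\ge a_5$; (D): $a_3+a_5\ge a_1$, $a_3+a_6\ge a_2$, $a_5+a_6\ge a_4$. One can reduce the facet $\{1,2,3\}$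 (resp. $\{1,4,5\}$, $\{2,4,6\}$, $\{3,5,6\}$) if (A) (resp. (B), (C), (D)) holds; the reduction then replaces $a_i$ by $\max\{0,a_i-1\}$ for the indices $i$ of that facet and leaves the other weights unchanged. The curve is S-minimal if no facet can be reduced, i.e. none of (A)–(D) holds. *)

theory Defs
  imports Complex_Main "HOL-Library.Poly_Mapping"
begin

section \<open>The polynomial ring \<open>R = k[a,b,c,d]\<close> and its ideals\<close>

datatype coord = CA | CB | CC | CD

text \<open>A polynomial maps exponent vectors to coefficients; multiplication on this type
  is the convolution product.\<close>

type_synonym 'k quad_poly = "(coord \<Rightarrow>\<^sub>0 nat) \<Rightarrow>\<^sub>0 'k"

definition Var :: "coord \<Rightarrow> 'k::field quad_poly" where
  "Var v = Poly_Mapping.single (Poly_Mapping.single v 1) 1"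

text \<open>Ideals are the submodules of the ring over itself.\<close>

definition ideal_gen :: "'r::comm_ring_1 set \<Rightarrow> 'r set" where
  "ideal_gen S = module.span (*) S"

fun ideal_pow :: "'r::comm_ring_1 set \<Rightarrow> nat \<Rightarrow> 'r set" where
  "ideal_pow I 0 = UNIV"
| "ideal_pow I (Suc n) = ideal_gen {f * g | f g. f \<in> I \<and> g \<in> ideal_pow I n}"

section \<open>Tetrahedral curves\<close>

text \<open>A closed subscheme of \<open>\<P>\<^sup>3\<close> is represented by its saturated homogeneous ideal in \<open>R\<close>.
  Weights \<open>(a\<^sub>1, \<dots>, a\<^sub>6)\<close> are given by a function of which only the values at \<open>1, \<dots>, 6\<close>
  matter.\<close>

definition tetrahedral_curve :: "(nat \<Rightarrow> nat) \<Rightarrow> 'k::field quad_poly set" where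
  "tetrahedral_curve a =
     ideal_pow (ideal_gen {Var CA, Var CB}) (a 1) \<inter>
     ideal_pow (ideal_gen {Var CA, Var CC}) (a 2) \<inter>
     ideal_pow (ideal_gen {Var CA, Var CD}) (a 3) \<inter>
     ideal_pow (ideal_gen {Var CB, Var CC}) (a 4) \<inter>
     ideal_pow (ideal_gen {Var CB, Var CD}) (a 5) \<inter>
     ideal_pow (ideal_gen {Var CC, Var CD}) (a 6)"

text \<open>Facets are given by the index sets of their edges.\<close>

definition facets :: "nat set set" where
  "facets = {{1,2,3}, {1,4,5}, {2,4,6}, {3,5,6}}"

definition facet_weight :: "(nat \<Rightarrow> nat) \<Rightarrow> nat set \<Rightarrow> nat" where
  "facet_weight a F = (\<Sum>i\<in>F. a i)"

section \<open>Reductions and S-minimality\<close>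

definition system_A :: "(nat \<Rightarrow> nat) \<Rightarrow> bool" where
  "system_A a \<longleftrightarrow> a 1 + a 2 \<ge> a 4 \<and> a 1 + a 3 \<ge> a 5 \<and> a 2 + a 3 \<ge> a 6"

definition system_B :: "(nat \<Rightarrow> nat) \<Rightarrow> bool" where
  "system_B a \<longleftrightarrow> a 1 + a 4 \<ge> a 2 \<and> a 1 + a 5 \<ge> a 3 \<and> a 4 + a 5 \<ge> a 6"

definition system_C :: "(nat \<Rightarrow> nat) \<Rightarrow> bool" where
  "system_C a \<longleftrightarrow> a 2 + a 4 \<ge> a 1 \<and> a 2 + a 6 \<ge> a 3 \<and> a 4 + a 6 \<ge> a 5"

definition system_D :: "(nat \<Rightarrow> nat) \<Rightarrow> bool" where
  "system_D a \<longleftrightarrow> a 3 + a 5 \<ge> a 1 \<and> a 3 + a 6 \<ge> a 2 \<and> a 5 + a 6 \<ge> a 4"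

definition facet_system :: "nat set \<Rightarrow> (nat \<Rightarrow> nat) \<Rightarrow> bool" where
  "facet_system F a \<longleftrightarrow>
     F = {1,2,3} \<and> system_A a \<or> F = {1,4,5} \<and> system_B a \<or>
     F = {2,4,6} \<and> system_C a \<or> F = {3,5,6} \<and> system_D a"

text \<open>\<open>reduces F C C'\<close>: reducing the facet \<open>F\<close> of the tetrahedral curve \<open>C\<close> is possible and
  gives \<open>C'\<close>.  The weights \<open>a\<close> of \<open>C\<close> are unique, see \<open>tetrahedral_curve_eq_iff\<close> below.
  Subtraction on naturals is truncated, so \<open>a i - 1\<close> is \<open>max {0, a\<^sub>i - 1}\<close>.  Reductions are
  considered only for curves with not all weights zero.\<close>

definition reduces ::
  "nat set \<Rightarrow> 'k::field quad_poly set \<Rightarrow> 'k quad_poly set \<Rightarrow> bool" where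
  "reduces F C C' \<longleftrightarrow>
     (\<exists>a. C = tetrahedral_curve a \<and> (\<exists>i\<in>{1..6}. a i \<noteq> 0) \<and> facet_system F a \<and>
          C' = tetrahedral_curve (\<lambda>i. if i \<in> F then a i - 1 else a i))"

definition can_reduce :: "'k::field quad_poly set \<Rightarrow> nat set \<Rightarrow> bool" where
  "can_reduce C F \<longleftrightarrow> (\<exists>C'. reduces F C C')"

definition S_minimal :: "'k::field quad_poly set \<Rightarrow> bool" where
  "S_minimal C \<longleftrightarrow> (\<forall>F\<in>facets. \<not> can_reduce C F)"

section \<open>The weights are determined by the curve\<close>

lemma module_times: "module ((*) :: 'r::comm_ring_1 \<Rightarrow> 'r \<Rightarrow> 'r)"
  by unfold_locales (simp_all add: algebra_simps)

lemma ideal_gen_base: "x \<in> S \<Longrightarrow> x \<in> ideal_gen S"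
  unfolding ideal_gen_def by (rule module.span_base[OF module_times])

lemma ideal_gen_mult: "x \<in> ideal_gen S \<Longrightarrow> r * x \<in> ideal_gen S"
  unfolding ideal_gen_def by (rule module.span_scale[OF module_times])

lemma ideal_gen_minimal:
  assumes "S \<subseteq> T" "0 \<in> T" "\<And>x y. x \<in> T \<Longrightarrow> y \<in> T \<Longrightarrow> x + y \<in> T" "\<And>r x. x \<in> T \<Longrightarrow> r * x \<in> T"
  shows "ideal_gen S \<subseteq> T"
  unfolding ideal_gen_def
  by (rule module.span_minimal[OF module_times assms(1)])
     (use assms in \<open>auto intro: module.subspaceI[OF module_times]\<close>)

definition deg_ge :: "coord \<Rightarrow> coord \<Rightarrow> nat \<Rightarrow> 'k::field quad_poly set" where
  "deg_ge x y n = {p. \<forall>m\<in>Poly_Mapping.keys p. n \<le> Poly_Mapping.lookup m x + Poly_Mapping.lookup m y}"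

lemma deg_ge_mult:
  assumes "p \<in> deg_ge x y i" "q \<in> deg_ge x y j"
  shows "p * q \<in> deg_ge x y (i + j)"
  unfolding deg_ge_def
proof safe
  fix m assume "m \<in> Poly_Mapping.keys (p * q)"
  then obtain u v where "m = u + v" "u \<in> Poly_Mapping.keys p" "v \<in> Poly_Mapping.keys q"
    using keys_mult[of p q] by blast
  then show "i + j \<le> Poly_Mapping.lookup m x + Poly_Mapping.lookup m y"
    using assms by (fastforce simp: deg_ge_def lookup_add)
qed

lemma ideal_gen_subset_deg_ge:
  assumes "S \<subseteq> deg_ge x y n" shows "ideal_gen S \<subseteq> deg_ge x y n"
proof (rule ideal_gen_minimal[OF assms])
  fix p q :: "'a quad_poly" assume "p \<in> deg_ge x y n" "q \<in> deg_ge x y n"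
  then show "p + q \<in> deg_ge x y n" using keys_add[of p q] by (auto simp: deg_ge_def)
next
  fix r p :: "'a quad_poly" assume "p \<in> deg_ge x y n"
  then show "r * p \<in> deg_ge x y n"
    using deg_ge_mult[of r x y 0 p n] by (simp add: deg_ge_def)
qed (simp add: deg_ge_def)

lemma ideal_pow_subset_deg_ge: "ideal_pow (ideal_gen {Var x, Var y}) n \<subseteq> deg_ge x y n"
proof (induction n)
  case 0 show ?case by (simp add: deg_ge_def)
next
  case (Suc n)
  have "ideal_gen {Var x, Var y} \<subseteq> (deg_ge x y 1 :: 'a quad_poly set)"
    by (rule ideal_gen_subset_deg_ge) (auto simp: deg_ge_def Var_def)
  then show ?case
    using Suc deg_ge_mult[of _ x y 1 _ n]
    by (auto intro!: ideal_gen_subset_deg_ge)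
qed

lemma monomial_in_ideal_pow_iff:
  assumes "x \<noteq> y"
  shows "Poly_Mapping.single m (1 :: 'k::field) \<in> ideal_pow (ideal_gen {Var x, Var y}) n \<longleftrightarrow>
     n \<le> Poly_Mapping.lookup m x + Poly_Mapping.lookup m y"
proof
  assume "Poly_Mapping.single m (1 :: 'k) \<in> ideal_pow (ideal_gen {Var x, Var y}) n"
  then show "n \<le> Poly_Mapping.lookup m x + Poly_Mapping.lookup m y"
    using ideal_pow_subset_deg_ge[of x y n] by (auto simp: deg_ge_def)
next
  assume "n \<le> Poly_Mapping.lookup m x + Poly_Mapping.lookup m y"
  then show "Poly_Mapping.single m (1 :: 'k) \<in> ideal_pow (ideal_gen {Var x, Var y}) n"
  proof (induction n arbitrary: m)
    case 0 show ?case by simp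
  next
    case (Suc n)
    then have "Poly_Mapping.lookup m x > 0 \<or> Poly_Mapping.lookup m y > 0" by linarith
    then obtain z where z: "z \<in> {x, y}" "Poly_Mapping.lookup m z > 0" by blast
    define m' where "m' = m - Poly_Mapping.single z 1"
    have m: "m = Poly_Mapping.single z 1 + m'"
      using z(2) by (intro poly_mapping_eqI) (auto simp: m'_def lookup_add lookup_minus lookup_single when_def)
    have "n \<le> Poly_Mapping.lookup m' x + Poly_Mapping.lookup m' y"
      using Suc.prems z assms unfolding m by (auto simp: lookup_add lookup_single when_def split: if_splits)
    then have "Poly_Mapping.single m' (1 :: 'k) \<in> ideal_pow (ideal_gen {Var x, Var y}) n"
      by (rule Suc.IH)
    moreover have "(Var z :: 'k quad_poly) \<in> ideal_gen {Var x, Var y}"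
      using z(1) by (auto intro: ideal_gen_base)
    moreover have "Poly_Mapping.single m (1 :: 'k) = Var z * Poly_Mapping.single m' 1"
      by (simp add: Var_def mult_single m)
    ultimately show ?case
      by (auto intro!: ideal_gen_base)
  qed
qed

lemma monomial_in_tetrahedral_curve_iff:
  "Poly_Mapping.single m (1 :: 'k::field) \<in> tetrahedral_curve a \<longleftrightarrow>
     a 1 \<le> Poly_Mapping.lookup m CA + Poly_Mapping.lookup m CB \<and> a 2 \<le> Poly_Mapping.lookup m CA + Poly_Mapping.lookup m CC \<and>
     a 3 \<le> Poly_Mapping.lookup m CA + Poly_Mapping.lookup m CD \<and> a 4 \<le> Poly_Mapping.lookup m CB + Poly_Mapping.lookup m CC \<and>
     a 5 \<le> Poly_Mapping.lookup m CB + Poly_Mapping.lookup m CD \<and> a 6 \<le> Poly_Mapping.lookup m CC + Poly_Mapping.lookup m CD"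
  by (simp add: tetrahedral_curve_def monomial_in_ideal_pow_iff)

lemma tetrahedral_curve_le:
  assumes "(tetrahedral_curve a :: 'k::field quad_poly set) \<subseteq> tetrahedral_curve b"
    and "i \<in> {1..6}"
  shows "b i \<le> a i"
proof -
  define N where "N = a 1 + a 2 + a 3 + a 4 + a 5 + a 6"
  define M :: "nat \<Rightarrow> nat \<Rightarrow> nat \<Rightarrow> nat \<Rightarrow> coord \<Rightarrow>\<^sub>0 nat" where
    "M p q r s = Poly_Mapping.single CA p + Poly_Mapping.single CB q +
                 Poly_Mapping.single CC r + Poly_Mapping.single CD s" for p q r s
  have M: "Poly_Mapping.lookup (M p q r s) CA = p" "Poly_Mapping.lookup (M p q r s) CB = q"
    "Poly_Mapping.lookup (M p q r s) CC = r" "Poly_Mapping.lookup (M p q r s) CD = s" for p q r s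
    by (simp_all add: M_def lookup_add lookup_single)
  have *: "Poly_Mapping.single m (1 :: 'k) \<in> tetrahedral_curve b"
    if "Poly_Mapping.single m (1 :: 'k) \<in> tetrahedral_curve a" for m
    using that assms(1) by blast
  note * = *[unfolded monomial_in_tetrahedral_curve_iff]
  have "i = 1 \<or> i = 2 \<or> i = 3 \<or> i = 4 \<or> i = 5 \<or> i = 6" using assms(2) by auto
  then show ?thesis
    using *[of "M (a 1) 0 N N"] *[of "M (a 2) N 0 N"] *[of "M (a 3) N N 0"]
      *[of "M N (a 4) 0 N"] *[of "M N (a 5) N 0"] *[of "M N N (a 6) 0"]
    unfolding M by (auto simp: N_def)
qed

lemma tetrahedral_curve_eq_iff:
  "(tetrahedral_curve a :: 'k::field quad_poly set) = tetrahedral_curve b \<longleftrightarrow>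
     (\<forall>i\<in>{1..6}. a i = b i)"
proof
  assume "(tetrahedral_curve a :: 'k quad_poly set) = tetrahedral_curve b"
  then show "\<forall>i\<in>{1..6}. a i = b i"
    using tetrahedral_curve_le[where ?'k = 'k] by (metis dual_order.antisym order_refl)
qed (simp add: tetrahedral_curve_def)

end

theory Submission
  imports Defs
begin

text \<open>Edges 1 and 6 are opposite, so each facet contains exactly one of them. The system of a
  facet includes the inequality bounding the weight of the other one by the sum of the facet's two
  remaining weights; adding the weight of the edge it contains turns this into
  \<open>a 1 + a 6\<close> \<le> weight of the facet. Hence any reducible facet gives (b).
  Conversely, under (b) a facet of weight \<open>w\<close> satisfies this inequality, and its two
  others follow from the maximality of \<open>a 6\<close> and of \<open>w\<close>. Since some facet
  has weight \<open>w\<close>, (c) gives (a). \<open>can_reduce_tetrahedral_curve_iff\<close>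
  carries reducibility from ideals to weights.\<close>

text \<open>\<open>reduces\<close> quantifies over all weights presenting the ideal; by
  \<open>tetrahedral_curve_eq_iff\<close> these agree with \<open>a\<close> on 1..6, the only values
  the systems see.\<close>

lemma can_reduce_tetrahedral_curve_iff:
  assumes "a 6 > 0"
  shows "can_reduce (tetrahedral_curve a :: 'k::field quad_poly set) F \<longleftrightarrow> facet_system F a"
proof
  assume "can_reduce (tetrahedral_curve a :: 'k quad_poly set) F"
  then obtain b where "(tetrahedral_curve a :: 'k quad_poly set) = tetrahedral_curve b"
    and b: "facet_system F b"
    unfolding can_reduce_def reduces_def by blast
  then have "\<forall>i\<in>{1..6}. a i = b i"
    by (simp only: tetrahedral_curve_eq_iff)
  then have "b 1 = a 1" "b 2 = a 2" "b 3 = a 3" "b 4 = a 4" "b 5 = a 5" "b 6 = a 6"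
    by auto
  with b show "facet_system F a"
    by (simp only: facet_system_def system_A_def system_B_def system_C_def system_D_def)
next
  assume "facet_system F a"
  moreover have "\<exists>i\<in>{1..6}. a i \<noteq> 0"
    using assms by (intro bexI[of _ 6]) auto
  ultimately show "can_reduce (tetrahedral_curve a :: 'k quad_poly set) F"
    unfolding can_reduce_def reduces_def by blast
qed

lemma facet_system_simps:
  "facet_system {1,2,3} a \<longleftrightarrow> system_A a"
  "facet_system {1,4,5} a \<longleftrightarrow> system_B a"
  "facet_system {2,4,6} a \<longleftrightarrow> system_C a"
  "facet_system {3,5,6} a \<longleftrightarrow> system_D a"
proof -
  \<comment> \<open>Distinctness leaves only one disjunct of \<open>facet_system\<close> alive for
    each facet.\<close>
  have "{1,2,3} \<noteq> {1,4,5::nat}" "{1,2,3} \<noteq> {2,4,6::nat}" "{1,2,3} \<noteq> {3,5,6::nat}"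
    "{1,4,5} \<noteq> {2,4,6::nat}" "{1,4,5} \<noteq> {3,5,6::nat}" "{2,4,6} \<noteq> {3,5,6::nat}"
    by (simp_all add: set_eq_subset)
  then show "facet_system {1,2,3} a \<longleftrightarrow> system_A a" "facet_system {1,4,5} a \<longleftrightarrow> system_B a"
    "facet_system {2,4,6} a \<longleftrightarrow> system_C a" "facet_system {3,5,6} a \<longleftrightarrow> system_D a"
    unfolding facet_system_def by metis+
qed

lemma facet_weight_simps:
  "facet_weight a {1,2,3} = a 1 + a 2 + a 3"
  "facet_weight a {1,4,5} = a 1 + a 4 + a 5"
  "facet_weight a {2,4,6} = a 2 + a 4 + a 6"
  "facet_weight a {3,5,6} = a 3 + a 5 + a 6"
  by (simp_all add: facet_weight_def)

theorem lemma3p8: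
  fixes a :: "nat \<Rightarrow> nat" and C :: "'k::field quad_poly set" and w :: nat
  assumes "C = tetrahedral_curve a"
    and "a 6 = Max {a 1, a 2, a 3, a 4, a 5, a 6}" and "a 6 > 0"
    and "w = Max {a 1 + a 2 + a 3, a 1 + a 4 + a 5, a 2 + a 4 + a 6, a 3 + a 5 + a 6}"
  shows "(\<not> S_minimal C \<longleftrightarrow> a 1 + a 6 \<le> w) \<and>
         (a 1 + a 6 \<le> w \<longleftrightarrow> (\<forall>F\<in>facets. facet_weight a F = w \<longrightarrow> can_reduce C F))"
proof -
  note systems = system_A_def system_B_def system_C_def system_D_def
  have reduce: "can_reduce C F \<longleftrightarrow> facet_system F a" for F
    unfolding assms(1) using assms(3) by (rule can_reduce_tetrahedral_curve_iff)
  have le6: "a 1 \<le> a 6" "a 2 \<le> a 6" "a 3 \<le> a 6" "a 4 \<le> a 6" "a 5 \<le> a 6"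
    by (subst assms(2), simp)+
  have w_ge: "a 1 + a 2 + a 3 \<le> w" "a 1 + a 4 + a 5 \<le> w" "a 2 + a 4 + a 6 \<le> w" "a 3 + a 5 + a 6 \<le> w"
    by (simp_all add: assms(4))
  have "w \<in> {a 1 + a 2 + a 3, a 1 + a 4 + a 5, a 2 + a 4 + a 6, a 3 + a 5 + a 6}"
    unfolding assms(4) by (rule Max_in) simp_all
  then have attained: "\<exists>F\<in>facets. facet_weight a F = w"
    unfolding facets_def bex_simps facet_weight_simps by auto
  have "a 1 + a 6 \<le> w" if "\<not> S_minimal C"
  proof -
    have "system_A a \<or> system_B a \<or> system_C a \<or> system_D a"
      using that by (simp only: S_minimal_def facets_def reduce ball_simps facet_system_simps) blast
    \<comment> \<open>The decisive inequalities are \<open>a 2 + a 3 \<ge> a 6\<close> in (A),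
      \<open>a 4 + a 5 \<ge> a 6\<close> in (B), \<open>a 2 + a 4 \<ge> a 1\<close> in (C) and
      \<open>a 3 + a 5 \<ge> a 1\<close> in (D).\<close>
    then show ?thesis
      unfolding systems using w_ge by linarith
  qed
  moreover have "\<forall>F\<in>facets. facet_weight a F = w \<longrightarrow> can_reduce C F" if "a 1 + a 6 \<le> w"
  proof -
    \<comment> \<open>Comparison with facet {3,5,6} gives
      \<open>a 1 + a 2 \<ge> a 5 + a 6 \<ge> a 4\<close>, and with {2,4,6} gives
      \<open>a 1 + a 3 \<ge> a 4 + a 6 \<ge> a 5\<close>. System (B) is analogous.\<close>
    have "system_A a" if "a 1 + a 2 + a 3 = w"
      unfolding system_A_def using that \<open>a 1 + a 6 \<le> w\<close> le6 w_ge by linarith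
    moreover have "system_B a" if "a 1 + a 4 + a 5 = w"
      unfolding system_B_def using that \<open>a 1 + a 6 \<le> w\<close> le6 w_ge by linarith
    \<comment> \<open>For a facet containing edge 6, the two inequalities with \<open>a 6\<close> on
      the larger side are immediate from its maximality.\<close>
    moreover have "system_C a" if "a 2 + a 4 + a 6 = w"
      unfolding system_C_def using that \<open>a 1 + a 6 \<le> w\<close> le6 w_ge by linarith
    moreover have "system_D a" if "a 3 + a 5 + a 6 = w"
      unfolding system_D_def using that \<open>a 1 + a 6 \<le> w\<close> le6 w_ge by linarith
    ultimately show ?thesis
      by (simp only: facets_def reduce ball_simps facet_system_simps facet_weight_simps simp_thms) blast
  qed
  \<comment> \<open>\<open>attained\<close> keeps the condition on facets of weight \<open>w\<close>
    from being vacuous.\<close>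
  moreover have "\<not> S_minimal C" if "\<forall>F\<in>facets. facet_weight a F = w \<longrightarrow> can_reduce C F"
    using that attained unfolding S_minimal_def by blast
  ultimately show ?thesis by blast
qed

end
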